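(* Let $[k]^+=\{0,1,\dots,k\}$. The formulation $$\min\ \mathbf f^\top\mathbf x+\mathbf c^\top\mathbf y+\frac1m\sum_{i=1}^n h_i\Theta'_i$$ subject to $$\sum_{i=1}^t y_i\ge\sum_{i=1}^t d_{ji}(1-z_j)\ \ (t\in N,\ j\in\Omega),\qquad \sum_{j=1}^m z_j\le k,\qquad y_i\le M_ix_i\ \ (i\in N),$$ $$\Theta'_i\ \ge\ (m-q)\sum_{p=1}^i y_p-\sum_{p=1}^{m-q}D_{\bar\sigma_{i(p)}}\qquad (i\in N,\ q\in[k]^+),$$ $$\mathbf x\in\{0,1\}^n,\ \mathbf y\in\mathbb R_+^n,\ \mathbf z\in\{0,1\}^m,\ \Theta'\in\mathbb R_+^n,$$ is equivalent to the deterministic equivalent formulation of the static probabilistic lot-sizing problem with equiprobable scenarios, $$\min\ \mathbf f^\top\mathbf x+\mathbf c^\top\mathbf y+\frac1m\sum_{j=1}^m\mathbf h^\top\mathbf s_j$$ subject to $$\sum_{i=1}^t y_i\ge\sum_{i=1}^t d_{ji}(1-z_j)\ \ (t\in N,\ j\in\Omega),\qquad \sum_{j=1}^m z_j\le k,\qquad y_i\le M_ix_i\ \ (i\in N),$$ $$s_{jt}\ge\sum_{i=1}^t(y_i-d_{ji})\ \ (t\in N,\ j\in\Omega),\quad \mathbf s_j\in\mathbb R_+^n\ (j\in\Omega),\ \mathbf y\in\mathbb R_+^n,\ \mathbf x\in\{0,1\}^n,\ \mathbf z\in\{0,1\}^m.$$ Here equivalence means: a triple $(\mathbf x,\mathbf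 y,\mathbf z)$ extends to a feasible solution of one problem if and only if it extends to a feasible solution of the other, and in that case the minimum objective value over all feasible extensions is the same for the two problems.
   Context: $N=\{1,\dots,n\}$ is the set of time periods and $\Omega=\{1,\dots,m\}$ the set of scenarios, each with probability $1/m$. $d_{ji}\ge0$ is the demand in period $i$ under scenario $j$; $0\le\epsilon<1$ is a given risk level and $k=\lfloor m\epsilon\rfloor$. $M_i=\max_{j\in\Omega}\sum_{p=i}^n d_{jp}$. $\mathbf f,\mathbf c\in\mathbb R^n$ are the vectors of fixed and unit production costs and $\mathbf h\in\mathbb R_+^n$ is the (nonnegative) vector of unit holding costs. $\mathbf s_j=(s_{j1},\dots,s_{jn})$ is the vector of inventories in scenario $j$; $\Theta'_i$ is an additional variable representing the total inventory in period $i$ over all scenarios. Cumulative demands: $D_{ji}=\sum_{p=1}^i d_{jp}$. For each $i\in N$, $\bar\sigma_{i(1)},\dots,\bar\sigma_{i(m)}$ is an ordering of the scenarios with $D_{\bar\sigma_{i(1)}i}\le D_{\bar\sigma_{i(2)}i}\le\cdots\le D_{\bar\sigma_{i(m)}i}$, and $D_{\bar\sigma_{i(p)}}$ abbreviates $D_{\bar\sigma_{i(p)}i}$. *)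

theory Defs
  imports Complex_Main
begin

text \<open>
  Periods are \<open>1..n\<close> and scenarios \<open>1..m\<close>. Vectors are functions on \<open>nat\<close> of which only the values
  at these indices matter; \<open>d j i\<close> is the demand of scenario \<open>j\<close> in period \<open>i\<close>, and \<open>s j i\<close> is the
  inventory of scenario \<open>j\<close> in period \<open>i\<close>.
\<close>

definition cum_demand :: "(nat \<Rightarrow> nat \<Rightarrow> real) \<Rightarrow> nat \<Rightarrow> nat \<Rightarrow> real" where
  "cum_demand d j i = (\<Sum>p=1..i. d j p)"

definition big_M :: "nat \<Rightarrow> nat \<Rightarrow> (nat \<Rightarrow> nat \<Rightarrow> real) \<Rightarrow> nat \<Rightarrow> real" where
  "big_M n m d i = Max ((\<lambda>j. \<Sum>p=i..n. d j p) ` {1..m})"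

text \<open>
  \<open>\<sigma> i p\<close> is the scenario with the \<open>p\<close>-th smallest cumulative demand up to period \<open>i\<close>,
  ties being broken arbitrarily.
\<close>

definition demand_ordering ::
  "nat \<Rightarrow> nat \<Rightarrow> (nat \<Rightarrow> nat \<Rightarrow> real) \<Rightarrow> (nat \<Rightarrow> nat \<Rightarrow> nat) \<Rightarrow> bool" where
  "demand_ordering n m d \<sigma> \<longleftrightarrow>
     (\<forall>i\<in>{1..n}. bij_betw (\<sigma> i) {1..m} {1..m} \<and>
        mono_on {1..m} (\<lambda>p. cum_demand d (\<sigma> i p) i))"

definition common_constraints ::
  "nat \<Rightarrow> nat \<Rightarrow> nat \<Rightarrow> (nat \<Rightarrow> nat \<Rightarrow> real) \<Rightarrow>
   (nat \<Rightarrow> real) \<Rightarrow> (nat \<Rightarrow> real) \<Rightarrow> (nat \<Rightarrow> real) \<Rightarrow> bool" where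
  "common_constraints n m k d x y z \<longleftrightarrow>
     (\<forall>t\<in>{1..n}. \<forall>j\<in>{1..m}. (\<Sum>i=1..t. y i) \<ge> (\<Sum>i=1..t. d j i * (1 - z j))) \<and>
     (\<Sum>j=1..m. z j) \<le> real k \<and>
     (\<forall>i\<in>{1..n}. y i \<le> big_M n m d i * x i) \<and>
     (\<forall>i\<in>{1..n}. x i \<in> {0, 1}) \<and>
     (\<forall>i\<in>{1..n}. y i \<ge> 0) \<and>
     (\<forall>j\<in>{1..m}. z j \<in> {0, 1})"

definition det_feasible ::
  "nat \<Rightarrow> nat \<Rightarrow> nat \<Rightarrow> (nat \<Rightarrow> nat \<Rightarrow> real) \<Rightarrow>
   (nat \<Rightarrow> real) \<Rightarrow> (nat \<Rightarrow> real) \<Rightarrow> (nat \<Rightarrow> real) \<Rightarrow> (nat \<Rightarrow> nat \<Rightarrow> real) \<Rightarrow> bool" where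
  "det_feasible n m k d x y z s \<longleftrightarrow>
     common_constraints n m k d x y z \<and>
     (\<forall>t\<in>{1..n}. \<forall>j\<in>{1..m}. s j t \<ge> (\<Sum>i=1..t. y i - d j i)) \<and>
     (\<forall>j\<in>{1..m}. \<forall>t\<in>{1..n}. s j t \<ge> 0)"

definition det_objective ::
  "nat \<Rightarrow> nat \<Rightarrow> (nat \<Rightarrow> real) \<Rightarrow> (nat \<Rightarrow> real) \<Rightarrow> (nat \<Rightarrow> real) \<Rightarrow>
   (nat \<Rightarrow> real) \<Rightarrow> (nat \<Rightarrow> real) \<Rightarrow> (nat \<Rightarrow> nat \<Rightarrow> real) \<Rightarrow> real" where
  "det_objective n m f c h x y s =
     (\<Sum>i=1..n. f i * x i) + (\<Sum>i=1..n. c i * y i) +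
     1 / real m * (\<Sum>j=1..m. \<Sum>i=1..n. h i * s j i)"

text \<open>
  The upper summation bound \<open>m - q\<close> is a subtraction on \<open>nat\<close>; it does not truncate as long as \<open>k \<le> m\<close>.
\<close>

definition agg_feasible ::
  "nat \<Rightarrow> nat \<Rightarrow> nat \<Rightarrow> (nat \<Rightarrow> nat \<Rightarrow> real) \<Rightarrow> (nat \<Rightarrow> nat \<Rightarrow> nat) \<Rightarrow>
   (nat \<Rightarrow> real) \<Rightarrow> (nat \<Rightarrow> real) \<Rightarrow> (nat \<Rightarrow> real) \<Rightarrow> (nat \<Rightarrow> real) \<Rightarrow> bool" where
  "agg_feasible n m k d \<sigma> x y z \<Theta> \<longleftrightarrow>
     common_constraints n m k d x y z \<and>
     (\<forall>i\<in>{1..n}. \<forall>q\<in>{0..k}.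
        \<Theta> i \<ge> (real m - real q) * (\<Sum>p=1..i. y p) - (\<Sum>p=1..m - q. cum_demand d (\<sigma> i p) i)) \<and>
     (\<forall>i\<in>{1..n}. \<Theta> i \<ge> 0)"

definition agg_objective ::
  "nat \<Rightarrow> nat \<Rightarrow> (nat \<Rightarrow> real) \<Rightarrow> (nat \<Rightarrow> real) \<Rightarrow> (nat \<Rightarrow> real) \<Rightarrow>
   (nat \<Rightarrow> real) \<Rightarrow> (nat \<Rightarrow> real) \<Rightarrow> (nat \<Rightarrow> real) \<Rightarrow> real" where
  "agg_objective n m f c h x y \<Theta> =
     (\<Sum>i=1..n. f i * x i) + (\<Sum>i=1..n. c i * y i) +
     1 / real m * (\<Sum>i=1..n. h i * \<Theta> i)"

end

theory Submission
  imports Defs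
begin

text \<open>
  Both problems are minimised by taking the inventories as small as possible: with
  \<open>Y = y\<^sub>1 + \<dots> + y\<^sub>i\<close>, the inventory of scenario \<open>j\<close> in period \<open>i\<close> is the positive part of \<open>Y - D\<^sub>j\<^sub>i\<close>.
  Summed over the scenarios in increasing order of demand, the positive parts equal the
  partial sum over the first \<open>m - q\<close> scenarios, where \<open>q\<close> is the number of scenarios with \<open>D\<^sub>j\<^sub>i > Y\<close>,
  and every other partial sum is at most that large. The scenarios counted by \<open>q\<close> have
  \<open>z\<^sub>j = 1\<close>, so \<open>q \<le> k\<close> and the inequality for \<open>q\<close> is among the constraints.
\<close>

text \<open>The arguments end in \<open>j i\<close>, as for \<open>s\<close>, so that
  \<open>excess d y\<close> is itself an inventory plan and can serve as a minimizer.\<close>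

definition excess :: "(nat \<Rightarrow> nat \<Rightarrow> real) \<Rightarrow> (nat \<Rightarrow> real) \<Rightarrow> nat \<Rightarrow> nat \<Rightarrow> real" where
  "excess d y j i = max 0 ((\<Sum>p=1..i. y p) - cum_demand d j i)"

text \<open>By monotonicity the set is closed downwards in \<open>{1..m}\<close>, hence an initial
  segment; its length is then its cardinality.\<close>

lemma sublevel_set_mono_on:
  fixes g :: "nat \<Rightarrow> 'a::linorder"
  assumes "mono_on {1..m} g"
  shows "{p \<in> {1..m}. g p \<le> a} = {1..card {p \<in> {1..m}. g p \<le> a}}"
proof -
  define A where "A = {p \<in> {1..m}. g p \<le> a}"
  have "\<exists>r. A = {1..r}"
  proof (cases "A = {}")
    case True
    then show ?thesis by (intro exI[of _ 0]) auto
  next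
    case False
    have fin: "finite A" unfolding A_def by simp
    have Max: "Max A \<in> A" using False fin by (rule Max_in[rotated])
    have "A = {1..Max A}"
    proof
      show "A \<subseteq> {1..Max A}" using fin by (auto simp: A_def)
    next
      show "{1..Max A} \<subseteq> A"
      proof
        fix p assume p: "p \<in> {1..Max A}"
        with Max have "p \<in> {1..m}" "Max A \<in> {1..m}" "p \<le> Max A" by (auto simp: A_def)
        then have "g p \<le> g (Max A)" by (rule mono_onD[OF assms])
        also have "\<dots> \<le> a" using Max by (simp add: A_def)
        finally show "p \<in> A" using \<open>p \<in> {1..m}\<close> by (simp add: A_def)
      qed
    qed
    then show ?thesis by blast
  qed
  then show ?thesis unfolding A_def[symmetric] by auto
qed

lemma sum_positive_part_mono_on:
  fixes g :: "nat \<Rightarrow> real"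
  assumes "mono_on {1..m} g"
  shows "(\<Sum>p=1..m. max 0 (a - g p)) = (\<Sum>p=1..card {p \<in> {1..m}. g p \<le> a}. a - g p)"
proof -
  let ?A = "{p \<in> {1..m}. g p \<le> a}"
  have "(\<Sum>p=1..m. max 0 (a - g p)) = (\<Sum>p\<in>?A. a - g p)"
    by (rule sum.mono_neutral_cong_right) (auto simp: max_def)
  \<comment> \<open>A single substitution: the equation contains its left-hand side again on the
    right.\<close>
  also have "\<dots> = (\<Sum>p=1..card ?A. a - g p)"
    by (subst sublevel_set_mono_on[OF assms]) (rule refl)
  finally show ?thesis .
qed

text \<open>Each term is at most its positive part, and prolonging a sum of nonnegative terms cannot
  decrease it.\<close>

lemma sum_le_sum_positive_part:
  fixes g :: "nat \<Rightarrow> real"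
  assumes "r \<le> m"
  shows "(\<Sum>p=1..r. a - g p) \<le> (\<Sum>p=1..m. max 0 (a - g p))"
proof -
  have "(\<Sum>p=1..r. a - g p) \<le> (\<Sum>p=1..r. max 0 (a - g p))"
    by (rule sum_mono) simp
  also have "\<dots> \<le> (\<Sum>p=1..m. max 0 (a - g p))"
    using assms by (intro sum_mono2) auto
  finally show ?thesis .
qed

text \<open>A scenario whose cumulative demand exceeds the production so far breaks its demand
  constraint unless \<open>z j = 1\<close>, and at most \<open>k\<close> scenarios have that
  value.\<close>

lemma card_unmet_le:
  assumes common: "common_constraints n m k d x y z" and i: "i \<in> {1..n}"
  shows "card {j \<in> {1..m}. (\<Sum>p=1..i. y p) < cum_demand d j i} \<le> k"
proof -
  let ?B = "{j \<in> {1..m}. (\<Sum>p=1..i. y p) < cum_demand d j i}"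
  have bin: "z j = 0 \<or> z j = 1" if "j \<in> {1..m}" for j
    using common that by (auto simp: common_constraints_def)
  have unmet: "z j = 1" if "j \<in> ?B" for j
  proof (rule ccontr)
    assume "z j \<noteq> 1"
    with bin that have "z j = 0" by blast
    moreover have "(\<Sum>p=1..i. d j p * (1 - z j)) \<le> (\<Sum>p=1..i. y p)"
      using common i that unfolding common_constraints_def by blast
    ultimately show False using that by (simp add: cum_demand_def)
  qed
  have "real (card ?B) = (\<Sum>j\<in>?B. z j)" using unmet by simp
  also have "\<dots> \<le> (\<Sum>j=1..m. z j)"
  proof (rule sum_mono2)
    show "0 \<le> z j" if "j \<in> {1..m} - ?B" for j
      using bin[of j] that by auto
  qed auto
  also have "\<dots> \<le> real k" using common by (simp add: common_constraints_def)
  finally show ?thesis by simp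
qed

text \<open>The largest of the lower bounds on \<open>\<Theta> i\<close> is the total excess. That
  it is attained at some \<open>q \<le> k\<close> comes from the common constraints, so
  \<open>main\<close> assumes them.\<close>

lemma agg_feasible_iff:
  assumes km: "k \<le> m" and ord: "demand_ordering n m d \<sigma>"
  shows "agg_feasible n m k d \<sigma> x y z \<Theta> \<longleftrightarrow>
    common_constraints n m k d x y z \<and> (\<forall>i\<in>{1..n}. \<Theta> i \<ge> (\<Sum>j=1..m. excess d y j i))"
proof -
  have main: "((\<forall>q\<in>{0..k}. \<Theta> i \<ge> (real m - real q) * (\<Sum>p=1..i. y p)
        - (\<Sum>p=1..m - q. cum_demand d (\<sigma> i p) i)) \<and> \<Theta> i \<ge> 0)
      \<longleftrightarrow> \<Theta> i \<ge> (\<Sum>j=1..m. excess d y j i)" (is "?L \<longleftrightarrow> ?R")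
    if common: "common_constraints n m k d x y z" and i: "i \<in> {1..n}" for i
  proof -
    define Y where "Y = (\<Sum>p=1..i. y p)"
    define g where "g p = cum_demand d (\<sigma> i p) i" for p
    have bij: "bij_betw (\<sigma> i) {1..m} {1..m}" and mono: "mono_on {1..m} g"
      using ord i unfolding demand_ordering_def g_def by blast+
    \<comment> \<open>Reindexing by \<open>\<sigma> i\<close> lists the scenarios by increasing
      demand.\<close>
    have S: "(\<Sum>j=1..m. excess d y j i) = (\<Sum>p=1..m. max 0 (Y - g p))"
      unfolding excess_def Y_def[symmetric] g_def
      by (rule sum.reindex_bij_betw[OF bij, symmetric])
    \<comment> \<open>For \<open>q \<le> m\<close> the subtraction on \<open>nat\<close> agrees with
      the real one.\<close>
    have partial: "(real m - real q) * Y - (\<Sum>p=1..m - q. g p) = (\<Sum>p=1..m - q. Y - g p)"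
      if "q \<le> m" for q
      using that by (simp add: sum_subtractf of_nat_diff)
    show ?thesis
    proof
      assume L: ?L
      let ?A = "{p \<in> {1..m}. g p \<le> Y}" and ?U = "{p \<in> {1..m}. Y < g p}"
      let ?q = "card ?U"
      \<comment> \<open>\<open>?U\<close> holds positions in the ordering; \<open>\<sigma> i\<close>
        carries them injectively to the unmet scenarios.\<close>
      have "inj_on (\<sigma> i) ?U" "\<sigma> i ` ?U \<subseteq> {j \<in> {1..m}. Y < cum_demand d j i}"
        using bij by (auto simp: bij_betw_def g_def intro: inj_on_subset)
      then have "?q \<le> card {j \<in> {1..m}. Y < cum_demand d j i}"
        by (rule card_inj_on_le) simp
      also have "\<dots> \<le> k"
        using card_unmet_le[OF common i] by (simp add: Y_def)
      finally have qk: "?q \<le> k" .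
      have "card (?A \<union> ?U) = card ?A + ?q" by (rule card_Un_disjoint) auto
      moreover have "?A \<union> ?U = {1..m}" by auto
      ultimately have A: "card ?A = m - ?q" by simp
      have "(\<Sum>j=1..m. excess d y j i) = (\<Sum>p=1..m - ?q. Y - g p)"
        unfolding S sum_positive_part_mono_on[OF mono] A ..
      also have "\<dots> = (real m - real ?q) * Y - (\<Sum>p=1..m - ?q. g p)"
        using partial[of ?q] qk km by simp
      also have "\<dots> \<le> \<Theta> i"
        using L qk unfolding Y_def g_def by auto
      finally show ?R .
    next
      assume R: ?R
      have "0 \<le> (\<Sum>j=1..m. excess d y j i)"
        by (rule sum_nonneg) (simp add: excess_def)
      moreover have "(real m - real q) * Y - (\<Sum>p=1..m - q. g p) \<le> (\<Sum>j=1..m. excess d y j i)"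
        if "q \<in> {0..k}" for q
      proof -
        have "q \<le> m" using that km by simp
        then show ?thesis
          unfolding S by (simp only: partial sum_le_sum_positive_part diff_le_self)
      qed
      ultimately show ?L using R unfolding Y_def g_def by force
    qed
  qed
  show ?thesis unfolding agg_feasible_def using main by blast
qed

text \<open>The two lower bounds on \<open>s j i\<close> merge into one maximum, which gives the
  same shape as \<open>agg_feasible_iff\<close>.\<close>

lemma det_feasible_iff:
  "det_feasible n m k d x y z s \<longleftrightarrow>
    common_constraints n m k d x y z \<and> (\<forall>i\<in>{1..n}. \<forall>j\<in>{1..m}. s j i \<ge> excess d y j i)"
  unfolding det_feasible_def excess_def cum_demand_def sum_subtractf max.bounded_iff by blast

lemma agg_objective_mono:
  assumes "\<And>i. i \<in> {1..n} \<Longrightarrow> h i \<ge> 0" and "\<And>i. i \<in> {1..n} \<Longrightarrow> \<Theta> i \<le> \<Theta>' i"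
  shows "agg_objective n m f c h x y \<Theta> \<le> agg_objective n m f c h x y \<Theta>'"
  unfolding agg_objective_def using assms
  by (intro add_left_mono mult_left_mono sum_mono) auto

text \<open>After exchanging the sums, the inventories enter the cost only through their totals per
  period.\<close>

lemma det_objective_eq_agg_objective:
  "det_objective n m f c h x y s = agg_objective n m f c h x y (\<lambda>i. \<Sum>j=1..m. s j i)"
  unfolding det_objective_def agg_objective_def
  by (subst sum.swap) (simp add: sum_distrib_left)

theorem proposition6:
  fixes n m k :: nat
    and \<epsilon> :: real
    and d :: "nat \<Rightarrow> nat \<Rightarrow> real"
    and f c h :: "nat \<Rightarrow> real"
    and \<sigma> :: "nat \<Rightarrow> nat \<Rightarrow> nat"
    and x y z :: "nat \<Rightarrow> real"
  assumes "n \<ge> 1" and "m \<ge> 1"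
    and "0 \<le> \<epsilon>" and "\<epsilon> < 1"
    and "k = nat \<lfloor>real m * \<epsilon>\<rfloor>"
    and "\<And>j i. j \<in> {1..m} \<Longrightarrow> i \<in> {1..n} \<Longrightarrow> d j i \<ge> 0"
    and "\<And>i. i \<in> {1..n} \<Longrightarrow> h i \<ge> 0"
    and "demand_ordering n m d \<sigma>"
  shows "((\<exists>\<Theta>. agg_feasible n m k d \<sigma> x y z \<Theta>) \<longleftrightarrow> (\<exists>s. det_feasible n m k d x y z s)) \<and>
    ((\<exists>s. det_feasible n m k d x y z s) \<longrightarrow>
      (\<exists>\<Theta> s. is_arg_min (agg_objective n m f c h x y) (agg_feasible n m k d \<sigma> x y z) \<Theta> \<and>
             is_arg_min (det_objective n m f c h x y) (det_feasible n m k d x y z) s \<and>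
             agg_objective n m f c h x y \<Theta> = det_objective n m f c h x y s))"
proof -
  have "real m * \<epsilon> \<le> real m" using assms(4) by (simp add: mult_left_le)
  then have "k \<le> m" unfolding assms(5) by linarith
  note agg_iff = agg_feasible_iff[OF this assms(8)]
  let ?\<Theta> = "\<lambda>i. \<Sum>j=1..m. excess d y j i"
  show ?thesis
  proof (intro conjI impI)
    \<comment> \<open>Each lower bound is its own witness, so both sides reduce to the common
      constraints.\<close>
    show "(\<exists>\<Theta>. agg_feasible n m k d \<sigma> x y z \<Theta>) \<longleftrightarrow> (\<exists>s. det_feasible n m k d x y z s)"
      unfolding agg_iff det_feasible_iff by (meson order_refl)
  next
    assume "\<exists>s. det_feasible n m k d x y z s"
    then have common: "common_constraints n m k d x y z"
      by (auto simp: det_feasible_def)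
    \<comment> \<open>A point that meets all its lower bounds with equality is minimal, as holding
      costs are nonnegative.\<close>
    have "is_arg_min (agg_objective n m f c h x y) (agg_feasible n m k d \<sigma> x y z) ?\<Theta>"
      unfolding is_arg_min_linorder agg_iff
      using common assms(7) by (auto intro!: agg_objective_mono)
    moreover have "is_arg_min (det_objective n m f c h x y) (det_feasible n m k d x y z) (excess d y)"
      unfolding is_arg_min_linorder det_feasible_iff det_objective_eq_agg_objective
      using common assms(7) by (auto intro!: agg_objective_mono sum_mono)
    moreover have "agg_objective n m f c h x y ?\<Theta> = det_objective n m f c h x y (excess d y)"
      by (simp only: det_objective_eq_agg_objective)
    ultimately show "\<exists>\<Theta> s. is_arg_min (agg_objective n m f c h x y) (agg_feasible n m k d \<sigma> x y z) \<Theta> \<and>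
        is_arg_min (det_objective n m f c h x y) (det_feasible n m k d x y z) s \<and>
        agg_objective n m f c h x y \<Theta> = det_objective n m f c h x y s"
      by blast
  qed
qed

end
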